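(* Let $N$, $c_n(E)$ and the real parameters be as in the context; in particular $N=-\lambda_1-\alpha_1\in\mathbb{Z}_{\ge 0}$, $\beta<1$, $\alpha_2-\alpha_1<1$, $t_1,t_2>0$, $h_1<h_2$, $l_1<l_2$. Assume that $h_2-l_1+1>0$ and that there exists $K\in\{1,2,\dots,N\}$ such that $-2K<1+h_2-l_2-\beta<-2K+2$. (i) The polynomial $c_{N+1}(E)$ satisfies $$c_{N+1}(E)\sim(t_1t_2)^{-N-1}\prod_{n=1}^{K}\left(Eq^{n-1-h_1-h_2+\lambda_1}+q^{2n-1/2-l_2-\beta}t_1\right)\prod_{n=K+1}^{N+1}\left(Eq^{n-1-h_1-h_2+\lambda_1}+q^{1/2-h_2}t_1\right)$$ $$=(t_1t_2)^{-N-1}q^{(N/2+\lambda_1-h_1-h_2)(N+1)}\prod_{n=1}^{K}\left(E+q^{n-3/2+\lambda_1+l_1+\alpha_1+\alpha_2}t_1\right)\prod_{n=K+1}^{N+1}\left(E+q^{-n+3/2+h_1-\lambda_1}t_1\right).$$ (ii) There exist solutions $E_j(q)$ $(j=1,2,\dots,N+1)$ to the equation $c_{N+1}(E)=0$ for sufficiently small $q>0$ such that $$E_j(q)\sim -q^{j-3/2+\lambda_1+l_1+\alpha_1+\alpha_2}t_1\quad (j=1,\dots,K),\qquad E_j(q)\sim -q^{-j+3/2+h_1-\lambda_1}t_1\quad (j=K+1,\dots,N+1).$$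
   Context: Throughout $0<q<1$, and $h_1,h_2,l_1,l_2,\alpha_1,\alpha_2,\beta,t_1,t_2$ are fixed real parameters independent of $q$. Put $\lambda_1=\frac{h_1+h_2-l_1-l_2-\alpha_1-\alpha_2-\beta+2}{2}$. Standing assumption: $N:=-\lambda_1-\alpha_1\in\mathbb{Z}_{\ge 0}$, $\beta<1$, $\alpha_2-\alpha_1<1$, $t_1>0$, $t_2>0$, $h_1<h_2$, $l_1<l_2$. The polynomials $c_n(E)$ in the indeterminate $E$ (of degree $n$, with coefficients depending on $q$) are defined by $c_{-1}(E)=0$, $c_0(E)=1$ and, for $n=1,\dots,N+1$, $$c_n(E)\,t_1t_2\,q^{h_1+h_2}(1-q^n)(1-q^{n-\beta})=c_{n-1}(E)\left[Eq^{n-1+\lambda_1}+q^{1/2}(q^{h_1}t_1+q^{h_2}t_2)+(q^{l_1}t_1+q^{l_2}t_2)q^{2(n+\lambda_1)+\alpha_1+\alpha_2-5/2}\right]-c_{n-2}(E)\,q(1-q^{n-2+\lambda_1+\alpha_1})(1-q^{n-2+\lambda_1+\alpha_2}).$$ The polynomial $c_{N+1}(E)$ is called the spectral polynomial of the $q$-Heun equation. For functions of $q$, $a(q)\sim b(q)$ means $\lim_{q\to+0}a(q)/b(q)=1$. For polynomials in $E$ with $q$-dependent coefficients, $\sum_{j=0}^{M}a_j(q)E^j\sim\sum_{j=0}^{M}b_j(q)E^j$ means $a_j(q)\sim b_j(q)$ for every $j=0,\dots,M$. *)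

theory Defs
  imports
    Complex_Main
    "HOL-Library.Landau_Symbols"
    "HOL-Computational_Algebra.Polynomial"
begin

definition qheun_lambda :: "real \<Rightarrow> real \<Rightarrow> real \<Rightarrow> real \<Rightarrow> real \<Rightarrow> real \<Rightarrow> real \<Rightarrow> real" where
  "qheun_lambda h1 h2 l1 l2 \<alpha>1 \<alpha>2 \<beta> = (h1 + h2 - l1 - l2 - \<alpha>1 - \<alpha>2 - \<beta> + 2) / 2"

text \<open>
  The three coefficients of the recurrence
  \<open>c\<^sub>n(E) \<cdot> lead n = c\<^sub>n\<^sub>-\<^sub>1(E) \<cdot> mid n - c\<^sub>n\<^sub>-\<^sub>2(E) \<cdot> last n\<close>.
  The middle one is a polynomial of degree 1 in \<open>E\<close>.
\<close>

definition qheun_lead :: "real \<Rightarrow> real \<Rightarrow> real \<Rightarrow> real \<Rightarrow> real \<Rightarrow> real \<Rightarrow> nat \<Rightarrow> real" where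
  "qheun_lead h1 h2 \<beta> t1 t2 q n =
     t1 * t2 * q powr (h1 + h2) * (1 - q ^ n) * (1 - q powr (real n - \<beta>))"

definition qheun_mid ::
  "real \<Rightarrow> real \<Rightarrow> real \<Rightarrow> real \<Rightarrow> real \<Rightarrow> real \<Rightarrow> real \<Rightarrow> real \<Rightarrow> real \<Rightarrow> real \<Rightarrow> nat \<Rightarrow> real poly" where
  "qheun_mid h1 h2 l1 l2 \<alpha>1 \<alpha>2 \<beta> t1 t2 q n =
     (let lam = qheun_lambda h1 h2 l1 l2 \<alpha>1 \<alpha>2 \<beta> in
      [: q powr (1/2) * (q powr h1 * t1 + q powr h2 * t2)
           + (q powr l1 * t1 + q powr l2 * t2)
               * q powr (2 * (real n + lam) + \<alpha>1 + \<alpha>2 - 5/2),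
         q powr (real n - 1 + lam) :])"

definition qheun_last ::
  "real \<Rightarrow> real \<Rightarrow> real \<Rightarrow> real \<Rightarrow> real \<Rightarrow> real \<Rightarrow> real \<Rightarrow> real \<Rightarrow> nat \<Rightarrow> real" where
  "qheun_last h1 h2 l1 l2 \<alpha>1 \<alpha>2 \<beta> q n =
     (let lam = qheun_lambda h1 h2 l1 l2 \<alpha>1 \<alpha>2 \<beta> in
      q * (1 - q powr (real n - 2 + lam + \<alpha>1)) * (1 - q powr (real n - 2 + lam + \<alpha>2)))"

text \<open>
  The polynomials \<open>c\<^sub>n(E)\<close>; the clause for \<open>n = 1\<close> incorporates \<open>c\<^sub>-\<^sub>1 = 0\<close>.  Since
  \<open>qheun_lead\<close> is nonzero for \<open>0 < q < 1\<close>, \<open>\<beta> < 1\<close>, \<open>t1, t2 > 0\<close> and \<open>n \<ge> 1\<close>, dividing by it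
  is harmless (see \<open>qheun_c_recurrence\<close>).
\<close>

fun qheun_c ::
  "real \<Rightarrow> real \<Rightarrow> real \<Rightarrow> real \<Rightarrow> real \<Rightarrow> real \<Rightarrow> real \<Rightarrow> real \<Rightarrow> real \<Rightarrow> real \<Rightarrow> nat \<Rightarrow> real poly" where
  "qheun_c h1 h2 l1 l2 \<alpha>1 \<alpha>2 \<beta> t1 t2 q 0 = 1"
| "qheun_c h1 h2 l1 l2 \<alpha>1 \<alpha>2 \<beta> t1 t2 q (Suc 0) =
     smult (1 / qheun_lead h1 h2 \<beta> t1 t2 q 1) (qheun_mid h1 h2 l1 l2 \<alpha>1 \<alpha>2 \<beta> t1 t2 q 1)"
| "qheun_c h1 h2 l1 l2 \<alpha>1 \<alpha>2 \<beta> t1 t2 q (Suc (Suc n)) =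
     smult (1 / qheun_lead h1 h2 \<beta> t1 t2 q (n + 2))
       (qheun_c h1 h2 l1 l2 \<alpha>1 \<alpha>2 \<beta> t1 t2 q (Suc n) * qheun_mid h1 h2 l1 l2 \<alpha>1 \<alpha>2 \<beta> t1 t2 q (n + 2)
        - smult (qheun_last h1 h2 l1 l2 \<alpha>1 \<alpha>2 \<beta> q (n + 2)) (qheun_c h1 h2 l1 l2 \<alpha>1 \<alpha>2 \<beta> t1 t2 q n))"

lemma qheun_lead_pos:
  assumes "0 < q" "q < 1" "\<beta> < 1" "t1 > 0" "t2 > 0" "n \<ge> 1"
  shows "qheun_lead h1 h2 \<beta> t1 t2 q n > 0"
proof -
  have "q ^ n < 1"
    using assms by (simp add: power_less_one_iff)
  moreover have "q powr (real n - \<beta>) < q powr 0"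
    using assms by (intro powr_less_mono') auto
  ultimately show ?thesis
    using assms by (simp add: qheun_lead_def)
qed

lemma qheun_c_recurrence:
  assumes "0 < q" "q < 1" "\<beta> < 1" "t1 > 0" "t2 > 0" "n \<ge> 1"
  shows "smult (qheun_lead h1 h2 \<beta> t1 t2 q n) (qheun_c h1 h2 l1 l2 \<alpha>1 \<alpha>2 \<beta> t1 t2 q n) =
    qheun_c h1 h2 l1 l2 \<alpha>1 \<alpha>2 \<beta> t1 t2 q (n - 1) * qheun_mid h1 h2 l1 l2 \<alpha>1 \<alpha>2 \<beta> t1 t2 q n
    - smult (qheun_last h1 h2 l1 l2 \<alpha>1 \<alpha>2 \<beta> q n)
        (if n = 1 then 0 else qheun_c h1 h2 l1 l2 \<alpha>1 \<alpha>2 \<beta> t1 t2 q (n - 2))"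
proof -
  have nz: "qheun_lead h1 h2 \<beta> t1 t2 q n \<noteq> 0"
    using qheun_lead_pos[OF assms] by (metis less_irrefl)
  consider "n = 1" | m where "n = Suc (Suc m)"
    using assms(6) by (metis One_nat_def not0_implies_Suc not_one_le_zero)
  then show ?thesis
    using nz by cases simp_all
qed

text \<open>
  Coefficientwise asymptotic equivalence, as \<open>q\<close> tends to \<open>0\<close> from the right, of polynomials
  with \<open>q\<close>-dependent coefficients.  As \<open>asymp_equiv\<close> relates \<open>0\<close> exactly to functions that
  vanish near \<open>0\<close>, letting \<open>j\<close> range over all of \<open>nat\<close> amounts to \<open>j \<le> M\<close> for two
  polynomials of degree at most \<open>M\<close>.
\<close>

definition poly_asymp_equiv :: "(real \<Rightarrow> real poly) \<Rightarrow> (real \<Rightarrow> real poly) \<Rightarrow> bool" where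
  "poly_asymp_equiv a b \<longleftrightarrow>
     (\<forall>j. (\<lambda>q. coeff (a q) j) \<sim>[at_right 0] (\<lambda>q. coeff (b q) j))"

end

theory Submission
  imports
    Defs
    "HOL-Computational_Algebra.Fundamental_Theorem_Algebra"
    "HOL-Real_Asymp.Real_Asymp"
begin

text \<open>
  After division by the leading factor, the constant term of the middle coefficient of the recurrence
  is dominated by \<open>q powr (2 * n - 1/2 - l2 - \<beta>) * t1\<close> for \<open>n \<le> K\<close> and by \<open>q powr (1/2 - h2) * t1\<close> for
  \<open>n > K\<close>, and the term with \<open>c\<^sub>n\<^sub>-\<^sub>2\<close> is of smaller order than the product of two consecutive such
  constant terms.  As all dominant coefficients are positive, nothing cancels, and \<open>c\<^sub>n\<close> is
  coefficientwise equivalent to the product of the dominant linear factors.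

  For the roots, the recurrence has the signs of one for orthogonal polynomials: for \<open>Im z > 0\<close> the ratio
  \<open>c\<^sub>n\<^sub>+\<^sub>1(z) / c\<^sub>n(z)\<close> stays in the upper half plane, so \<open>c\<^sub>N\<^sub>+\<^sub>1\<close> has only real roots.  A real-rooted
  polynomial that is coefficientwise equivalent to a product of factors \<open>E + r\<close> has a root
  asymptotic to each \<open>- r\<close>.
\<close>

section \<open>Root distances in the complex plane, and half planes preserved by a
  recurrence\<close>

lemma poly_of_real_poly: "poly (map_poly of_real p) (of_real x) = (of_real (poly p x) :: complex)"
  by (induction p) (auto simp: map_poly_pCons)

text \<open>Each root \<open>z\<close> satisfies \<open>norm (b - z) \<le> norm (a - b) + norm (a -
  z) \<le> 2 * norm (a - z)\<close>; multiplying over the roots of the factorised polynomial gives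
  the bound. A degree bound \<open>M\<close> in the exponent keeps the constant uniform over a
  family of polynomials.\<close>

lemma norm_poly_le_of_distant_roots:
  fixes p :: "complex poly"
  assumes deg: "degree p \<le> M"
    and dist: "\<And>z. poly p z = 0 \<Longrightarrow> norm (a - b) \<le> norm (a - z)"
  shows "norm (poly p b) \<le> 2 ^ M * norm (poly p a)"
proof (cases "p = 0")
  case False
  then obtain A where A: "size A = degree p" "p = smult (lead_coeff p) (\<Prod>x\<in>#A. [:-x, 1:])"
    using alg_closed_imp_factorization by blast
  have nn: "(\<Prod>z\<in>#B. norm (x - z)) \<ge> 0" for x :: complex and B
    by (induction B) auto
  have ev: "norm (poly p x) = norm (lead_coeff p) * (\<Prod>z\<in>#A. norm (x - z))" for x
  proof -
    have "norm (poly (\<Prod>z\<in>#B. [:-z, 1:]) x) = (\<Prod>z\<in>#B. norm (x - z))" for B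
      by (simp add: poly_prod_mset) (induction B; simp add: norm_mult)
    then show ?thesis
      by (subst A(2)) (simp add: norm_mult)
  qed
  have "norm (a - b) \<le> norm (a - z)" if "z \<in># A" for z
  proof (rule dist)
    have "poly (\<Prod>x\<in>#B. [:-x, 1:]) z = 0" if "z \<in># B" for B
      using that by (induction B) auto
    then show "poly p z = 0"
      using that by (subst A(2)) simp
  qed
  then have "norm (b - z) \<le> 2 * norm (a - z)" if "z \<in># A" for z
    using that norm_triangle_ineq4[of "a - z" "a - b"] by fastforce
  then have "(\<Prod>z\<in>#A. norm (b - z)) \<le> 2 ^ size A * (\<Prod>z\<in>#A. norm (a - z))"
  proof (induction A)
    case (add x B)
    then have "norm (b - x) * (\<Prod>z\<in>#B. norm (b - z)) \<le> (2 * norm (a - x)) * (2 ^ size B * (\<Prod>z\<in>#B. norm (a - z)))"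
      by (intro mult_mono) (auto simp: nn)
    then show ?case by (simp add: mult_ac)
  qed auto
  also have "\<dots> \<le> 2 ^ M * (\<Prod>z\<in>#A. norm (a - z))"
    using A deg by (intro mult_right_mono power_increasing nn) auto
  finally show ?thesis
    unfolding ev by (subst mult.left_commute) (intro mult_left_mono norm_ge_zero)
qed auto

text \<open>If \<open>w\<close> is one ratio of consecutive terms, the next is
  \<open>A - d / w\<close>. For \<open>d > 0\<close> the number \<open>- d / w\<close> lies in the
  same half plane as \<open>w\<close>, so the ratios never leave the half plane of the
  \<open>A n\<close>. The factor \<open>\<sigma>\<close> records which half plane this is;
  \<open>\<sigma> = Im z\<close> later treats both at once.\<close>

lemma recurrence_Im_pos:
  fixes c A D :: "nat \<Rightarrow> complex" and \<sigma> :: real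
  assumes "c 0 = 1" "c 1 = A 1"
    and rec: "\<And>n. n + 2 \<le> M \<Longrightarrow> c (n + 2) = c (n + 1) * A (n + 2) - of_real (d (n + 2)) * c n"
    and A: "\<And>n. 1 \<le> n \<Longrightarrow> n \<le> M \<Longrightarrow> \<sigma> * Im (A n) > 0"
    and d: "\<And>n. 2 \<le> n \<Longrightarrow> n \<le> M \<Longrightarrow> d n > 0"
  shows "Suc n \<le> M \<Longrightarrow> c n \<noteq> 0 \<and> c (Suc n) \<noteq> 0 \<and> \<sigma> * Im (c (Suc n) / c n) > 0"
proof (induction n)
  case 0
  then show ?case using A[of 1] assms(1,2) by auto
next
  case (Suc n)
  then have nz: "c n \<noteq> 0" "c (Suc n) \<noteq> 0" and pos: "\<sigma> * Im (c (Suc n) / c n) > 0" by auto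
  define w where "w = c (Suc n) / c n"
  have w0: "w \<noteq> 0" using nz by (simp add: w_def)
  have "c (Suc (Suc n)) / c (Suc n) = A (n + 2) - of_real (d (n + 2)) / w"
    using rec[of n] Suc.prems nz by (simp add: w_def field_simps)
  moreover have "\<sigma> * Im (A (n + 2) - of_real (d (n + 2)) / w)
      = \<sigma> * Im (A (n + 2)) + d (n + 2) * (\<sigma> * Im w) / (cmod w)\<^sup>2"
    by (simp add: Im_divide cmod_power2 algebra_simps diff_divide_distrib)
  moreover have "d (n + 2) * (\<sigma> * Im w) / (cmod w)\<^sup>2 > 0"
    using d[of "n + 2"] Suc.prems pos w0 by (simp add: w_def)
  ultimately have "\<sigma> * Im (c (Suc (Suc n)) / c (Suc n)) > 0"
    using A[of "n + 2"] Suc.prems by auto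
  then show ?case using nz by auto
qed

section \<open>Coefficientwise equivalence under products and three-term recurrences\<close>

text \<open>Asymptotic equivalence is not additive in general. Here the summands of each Cauchy
  product on the right are nonnegative, so each is bounded by the whole sum and the error of each
  summand is negligible against it.\<close>

lemma poly_asymp_equiv_mult:
  assumes "poly_asymp_equiv a b" "poly_asymp_equiv c d"
    and nn: "\<And>q j. coeff (b q) j \<ge> 0" "\<And>q j. coeff (d q) j \<ge> 0"
  shows "poly_asymp_equiv (\<lambda>q. a q * c q) (\<lambda>q. b q * d q)"
  unfolding poly_asymp_equiv_def
proof
  fix j
  let ?f = "\<lambda>i q. coeff (a q) i * coeff (c q) (j - i)"
  let ?g = "\<lambda>i q. coeff (b q) i * coeff (d q) (j - i)"
  have "(\<lambda>q. ?f i q - ?g i q) \<in> o[at_right 0](\<lambda>q. \<Sum>i\<le>j. ?g i q)" if "i \<in> {..j}" for i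
  proof -
    have "?f i \<sim>[at_right 0] ?g i"
      using assms(1,2) by (intro asymp_equiv_intros) (auto simp: poly_asymp_equiv_def)
    then have "(\<lambda>q. ?f i q - ?g i q) \<in> o[at_right 0](?g i)"
      by (rule asymp_equiv_imp_diff_smallo)
    moreover have "?g i \<in> O[at_right 0](\<lambda>q. \<Sum>i\<le>j. ?g i q)"
    proof (rule bigoI[of _ 1], rule always_eventually, rule allI)
      fix q
      have "?g i q \<le> (\<Sum>i\<le>j. ?g i q)"
        using that nn by (intro member_le_sum) auto
      moreover have "?g i q \<ge> 0" "(\<Sum>i\<le>j. ?g i q) \<ge> 0"
        using nn by (auto intro!: sum_nonneg)
      ultimately show "norm (?g i q) \<le> 1 * norm (\<Sum>i\<le>j. ?g i q)"
        unfolding real_norm_def by linarith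
    qed
    ultimately show ?thesis
      by (rule landau_o.small_big_trans)
  qed
  then have "(\<lambda>q. \<Sum>i\<le>j. (?f i q - ?g i q)) \<in> o[at_right 0](\<lambda>q. \<Sum>i\<le>j. ?g i q)"
    by (rule big_sum_in_smallo)
  then show "(\<lambda>q. coeff (a q * c q) j) \<sim>[at_right 0] (\<lambda>q. coeff (b q * d q) j)"
    unfolding asymp_equiv_altdef coeff_mult by (simp add: sum_subtractf)
qed

lemma coeff_mult_nonneg:
  fixes p r :: "real poly"
  assumes "\<And>j. coeff p j \<ge> 0" "\<And>j. coeff r j \<ge> 0"
  shows "coeff (p * r) j \<ge> 0"
  using assms by (auto simp: coeff_mult intro!: sum_nonneg)

lemma coeff_prod_nonneg:
  fixes p :: "'a \<Rightarrow> real poly"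
  assumes "\<And>i j. i \<in> I \<Longrightarrow> coeff (p i) j \<ge> 0"
  shows "coeff (\<Prod>i\<in>I. p i) j \<ge> 0"
  using assms
proof (induction I arbitrary: j rule: infinite_finite_induct)
  case (insert x F)
  then show ?case by (simp add: coeff_mult_nonneg)
qed (auto simp: coeff_1)

text \<open>The product with \<open>m n\<close> already has the claimed equivalent. The subtracted
  term is negligible: its \<open>j\<close>-th coefficient is of smaller order than the
  \<open>j\<close>-th coefficient of the product up to \<open>n - 2\<close> times the constant terms
  of \<open>b (n - 1)\<close> and \<open>b n\<close>, which is one of the nonnegative summands of
  the \<open>j\<close>-th coefficient of the product up to \<open>n\<close>.\<close>

lemma poly_asymp_equiv_recurrence:
  fixes c m b :: "nat \<Rightarrow> real \<Rightarrow> real poly" and d :: "nat \<Rightarrow> real \<Rightarrow> real"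
  assumes "\<And>q. c 0 q = 1" "\<And>q. c 1 q = m 1 q"
    and rec: "\<And>n q. c (n + 2) q = c (n + 1) q * m (n + 2) q - smult (d (n + 2) q) (c n q)"
    and m: "\<And>n. 1 \<le> n \<Longrightarrow> n \<le> M \<Longrightarrow> poly_asymp_equiv (m n) (b n)"
    and nn: "\<And>n q j. coeff (b n q) j \<ge> 0"
    and d: "\<And>n. 2 \<le> n \<Longrightarrow> n \<le> M \<Longrightarrow>
      d n \<in> o[at_right 0](\<lambda>q. coeff (b (n - 1) q) 0 * coeff (b n q) 0)"
  shows "n \<le> M \<Longrightarrow> poly_asymp_equiv (c n) (\<lambda>q. \<Prod>i=1..n. b i q)"
proof (induction n rule: less_induct)
  case (less n)
  let ?P = "\<lambda>n q. \<Prod>i=1..n. b i q"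
  have nnP: "coeff (?P n q) j \<ge> 0" for n q j
    by (intro coeff_prod_nonneg nn)
  consider "n = 0" | "n = 1" | k where "n = k + 2"
    by (metis One_nat_def add_2_eq_Suc' not0_implies_Suc)
  then show ?case
  proof cases
    case 1
    then show ?thesis using assms(1) by (simp add: poly_asymp_equiv_def)
  next
    case 2
    have "c 1 = m 1" using assms(2) by auto
    then show ?thesis using 2 m[of 1] less.prems by simp
  next
    case (3 k)
    have P2: "?P (k + 2) q = ?P (k + 1) q * b (k + 2) q" "?P (k + 1) q = ?P k q * b (k + 1) q" for q
      by simp_all
    have main: "poly_asymp_equiv (\<lambda>q. c (k + 1) q * m (k + 2) q) (\<lambda>q. ?P (k + 1) q * b (k + 2) q)"
      using less.IH[of "k + 1"] less.prems 3 by (intro poly_asymp_equiv_mult m nn nnP) simp_all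
    show ?thesis
      unfolding poly_asymp_equiv_def
    proof
      fix j
      have "(\<lambda>q. coeff (c k q) j) \<in> O[at_right 0](\<lambda>q. coeff (?P k q) j)"
        using less 3 by (intro asymp_equiv_imp_bigo) (auto simp: poly_asymp_equiv_def)
      then have "(\<lambda>q. d (k + 2) q * coeff (c k q) j) \<in>
          o[at_right 0](\<lambda>q. (coeff (b (k + 1) q) 0 * coeff (b (k + 2) q) 0) * coeff (?P k q) j)"
        using d[of "k + 2"] less 3 by (intro landau_o.small_big_mult) auto
      moreover have "(\<lambda>q. (coeff (b (k + 1) q) 0 * coeff (b (k + 2) q) 0) * coeff (?P k q) j)
          \<in> O[at_right 0](\<lambda>q. coeff (?P (k + 2) q) j)"
      proof (rule bigoI[of _ 1], rule always_eventually, rule allI)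
        fix q
        have le: "coeff p j * coeff r 0 \<le> coeff (p * r) j"
          if "\<And>j. coeff p j \<ge> 0" "\<And>j. coeff r j \<ge> 0" for p r :: "real poly"
        proof -
          have "(\<lambda>i. coeff p i * coeff r (j - i)) j \<le> (\<Sum>i\<le>j. coeff p i * coeff r (j - i))"
            using that by (intro member_le_sum) auto
          then show ?thesis by (simp add: coeff_mult)
        qed
        have "coeff (?P k q) j * coeff (b (k + 1) q) 0 * coeff (b (k + 2) q) 0
            \<le> coeff (?P (k + 1) q) j * coeff (b (k + 2) q) 0"
          unfolding P2(2) by (intro mult_right_mono le nn nnP)
        also have "\<dots> \<le> coeff (?P (k + 2) q) j"
          unfolding P2(1) by (intro le nn nnP)
        finally show "norm ((coeff (b (k + 1) q) 0 * coeff (b (k + 2) q) 0) * coeff (?P k q) j)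
            \<le> 1 * norm (coeff (?P (k + 2) q) j)"
          using nn nnP by (simp add: mult_ac abs_mult)
      qed
      ultimately have "(\<lambda>q. - (d (k + 2) q * coeff (c k q) j)) \<in> o[at_right 0](\<lambda>q. coeff (?P (k + 2) q) j)"
        using landau_o.small_big_trans by simp
      then have "(\<lambda>q. coeff (c (k + 1) q * m (k + 2) q) j + - (d (k + 2) q * coeff (c k q) j))
          \<sim>[at_right 0] (\<lambda>q. coeff (?P (k + 2) q) j)"
        using main unfolding P2 poly_asymp_equiv_def by (subst asymp_equiv_add_right) auto
      then show "(\<lambda>q. coeff (c n q) j) \<sim>[at_right 0] (\<lambda>q. coeff (?P n q) j)"
        using rec[of k] 3 by simp
    qed
  qed
qed

section \<open>From equivalent coefficients to equivalent roots\<close>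

text \<open>The roots given by \<open>near\<close> may change with \<open>\<epsilon>\<close>. A root
  closest to \<open>r q\<close>, which exists because a nonzero polynomial has finitely many roots,
  is at least as good as each of them, so one choice serves every \<open>\<epsilon>\<close>.\<close>

lemma closest_root_asymp_equiv:
  fixes c :: "real \<Rightarrow> real poly" and r :: "real \<Rightarrow> real"
  assumes nz: "\<forall>\<^sub>F q in F. c q \<noteq> 0"
    and near: "\<And>\<epsilon>. \<epsilon> > 0 \<Longrightarrow> \<forall>\<^sub>F q in F. \<exists>x. poly (c q) x = 0 \<and> \<bar>x - r q\<bar> \<le> \<epsilon> * \<bar>r q\<bar>"
  shows "\<exists>E. (\<forall>\<^sub>F q in F. poly (c q) (E q) = 0) \<and> E \<sim>[F] r"
proof -
  define E where "E = (\<lambda>q. arg_min_on (\<lambda>x. \<bar>x - r q\<bar>) {x. poly (c q) x = 0})"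
  have E: "poly (c q) (E q) = 0 \<and> \<bar>E q - r q\<bar> \<le> \<bar>x - r q\<bar>"
    if "c q \<noteq> 0" "poly (c q) x = 0" for q x
  proof -
    have fin: "finite {x. poly (c q) x = 0}" by (rule poly_roots_finite[OF that(1)])
    then show ?thesis
      using arg_min_if_finite(1)[OF fin, of "\<lambda>x. \<bar>x - r q\<bar>"]
        arg_min_least[OF fin, of x "\<lambda>x. \<bar>x - r q\<bar>"] that
      unfolding E_def by blast
  qed
  have "\<forall>\<^sub>F q in F. poly (c q) (E q) = 0"
    using near[OF zero_less_one] nz by eventually_elim (use E in blast)
  moreover have "E \<sim>[F] r"
  proof (rule smallo_imp_asymp_equiv, rule landau_o.smallI)
    fix \<epsilon> :: real assume "\<epsilon> > 0"
    from near[OF this] nz show "\<forall>\<^sub>F q in F. norm (E q - r q) \<le> \<epsilon> * norm (r q)"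
      by eventually_elim (use E in fastforce)
  qed
  ultimately show ?thesis by blast
qed

text \<open>The error is measured against \<open>r\<close> at \<open>\<bar>x\<bar>\<close>, where
  the terms add up without cancellation. The bound thus remains usable at negative \<open>x\<close>,
  even at a zero of \<open>r\<close>.\<close>

lemma abs_poly_diff_le:
  fixes p r :: "real poly"
  assumes "degree p \<le> M" "degree r \<le> M"
    and "\<And>j. j \<le> M \<Longrightarrow> \<bar>coeff p j - coeff r j\<bar> \<le> \<delta> * coeff r j"
  shows "\<bar>poly p x - poly r x\<bar> \<le> \<delta> * poly r \<bar>x\<bar>"
proof -
  have ev: "poly s y = (\<Sum>j\<le>M. coeff s j * y ^ j)" if "degree s \<le> M" for s :: "real poly" and y
    by (subst poly_as_sum_of_monoms'[OF that, symmetric]) (simp add: poly_sum poly_monom)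
  have "\<bar>poly p x - poly r x\<bar> = \<bar>\<Sum>j\<le>M. (coeff p j - coeff r j) * x ^ j\<bar>"
    using assms by (simp add: ev sum_subtractf algebra_simps)
  also have "\<dots> \<le> (\<Sum>j\<le>M. \<bar>coeff p j - coeff r j\<bar> * \<bar>x\<bar> ^ j)"
    by (rule order.trans[OF sum_abs]) (simp add: abs_mult power_abs)
  also have "\<dots> \<le> (\<Sum>j\<le>M. \<delta> * coeff r j * \<bar>x\<bar> ^ j)"
    using assms(3) by (intro sum_mono mult_right_mono) auto
  also have "\<dots> = \<delta> * poly r \<bar>x\<bar>"
    using assms by (simp add: ev sum_distrib_left mult_ac)
  finally show ?thesis .
qed

lemma poly_prod_linear:
  fixes r :: "'a \<Rightarrow> real"
  shows "poly (smult A (\<Prod>n\<in>I. [:r n, 1:])) x = A * (\<Prod>n\<in>I. r n + x)"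
  by (simp add: poly_prod)

lemma filterlim_powr_neg_at_right_0:
  assumes "a < (0::real)"
  shows "filterlim (\<lambda>q::real. q powr a) at_top (at_right 0)"
  using assms by real_asymp

text \<open>
  Write \<open>r = q powr s n * t\<close>, \<open>y = (1 + \<epsilon>) * r\<close> and let \<open>T\<close> be the value of the model polynomial at
  \<open>y\<close>.  Then \<open>c\<close> is \<open>o(T)\<close> at \<open>- r\<close>, where the model vanishes, but at least a constant multiple of \<open>T\<close>
  at \<open>- y\<close>; if all roots were at distance at least \<open>\<epsilon> * r\<close> from \<open>- r\<close>, these two values would be
  comparable.  The exponents \<open>s\<close> may coincide, which is why real-rootedness is assumed: a double root
  of the model could otherwise split into a conjugate pair.
\<close>
lemma root_near_of_real_rooted:
  fixes c :: "real \<Rightarrow> real poly" and s :: "'a \<Rightarrow> real"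
  assumes fin: "finite I" and n: "n \<in> I" and t: "t > 0" and A: "\<And>q. q > 0 \<Longrightarrow> A q > 0"
    and P: "poly_asymp_equiv c (\<lambda>q. smult (A q) (\<Prod>n\<in>I. [:q powr s n * t, 1:]))"
    and deg: "\<And>q. degree (c q) \<le> card I"
    and real: "\<forall>\<^sub>F q in at_right 0. \<forall>z. poly (map_poly complex_of_real (c q)) z = 0 \<longrightarrow> z \<in> \<real>"
    and e: "\<epsilon> > 0"
  shows "\<forall>\<^sub>F q in at_right 0. \<exists>x. poly (c q) x = 0 \<and> \<bar>x - - (q powr s n) * t\<bar> \<le> \<epsilon> * \<bar>- (q powr s n) * t\<bar>"
proof -
  define M where "M = card I"
  define P where "P = (\<lambda>q. smult (A q) (\<Prod>n\<in>I. [:q powr s n * t, 1:]))"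
  \<comment> \<open>Lower bound for the ratio of the absolute values of the model at
    \<open>- y\<close> and at \<open>y\<close>; each of the \<open>M\<close> linear factors
    contributes \<open>\<epsilon> / (2 + \<epsilon>)\<close>.\<close>
  define \<kappa> where "\<kappa> = (\<epsilon> / (2 + \<epsilon>)) ^ M"
  have \<kappa>: "\<kappa> > 0" using e by (simp add: \<kappa>_def)
  \<comment> \<open>Chosen so that \<open>2 ^ M * \<delta> < \<kappa> - \<delta>\<close>, which the
    final comparison contradicts.\<close>
  define \<delta> where "\<delta> = \<kappa> / (2 ^ M + 2)"
  have pos2: "(2::real) ^ M + 2 > 0" by (simp add: add_pos_pos)
  have \<delta>: "\<delta> > 0" using \<kappa> pos2 by (simp add: \<delta>_def)
  have \<delta>2: "2 ^ M * \<delta> < \<kappa> - \<delta>"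
  proof -
    have "\<kappa> = \<delta> * (2 ^ M + 2)" using pos2 by (simp add: \<delta>_def)
    then show ?thesis using \<delta> by (simp add: algebra_simps)
  qed
  have nnP: "coeff (P q) j \<ge> 0" if "q > 0" for q j
    unfolding P_def coeff_smult using A[OF that] t
    by (intro mult_nonneg_nonneg coeff_prod_nonneg) (auto simp: coeff_pCons split: nat.splits)
  have degP: "degree (P q) \<le> M" for q
  proof -
    have "degree (\<Prod>n\<in>I. [:q powr s n * t, 1:]) \<le> (\<Sum>n\<in>I. degree [:q powr s n * t, 1:])"
      using degree_prod_sum_le[OF fin, of "\<lambda>n. [:q powr s n * t, 1:]"] by (simp add: o_def)
    also have "\<dots> = M" by (simp add: M_def)
    finally show ?thesis unfolding P_def using degree_smult_le order.trans by blast
  qed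
  have "\<forall>\<^sub>F q in at_right 0. norm (coeff (c q) j - coeff (P q) j) \<le> \<delta> * norm (coeff (P q) j)" for j
    using assms(5) \<delta> unfolding poly_asymp_equiv_def P_def[symmetric]
    by (intro landau_o.smallD asymp_equiv_imp_diff_smallo) (auto simp: P_def)
  then have ev1: "\<forall>\<^sub>F q in at_right 0. \<forall>j\<in>{..M}. norm (coeff (c q) j - coeff (P q) j) \<le> \<delta> * norm (coeff (P q) j)"
    by (intro eventually_ball_finite) auto
  \<comment> \<open>Model roots of strictly larger order eventually exceed \<open>r\<close> by the
    factor \<open>(1 + \<epsilon>)\<^sup>2\<close>, hence \<open>y\<close> by the factor
    \<open>1 + \<epsilon>\<close>.\<close>
  have "\<forall>\<^sub>F q in at_right 0. s m < s n \<longrightarrow> q powr (s m - s n) \<ge> (1 + \<epsilon>)\<^sup>2" for m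
  proof (cases "s m < s n")
    case True
    then have "s m - s n < 0" by simp
    then have "filterlim (\<lambda>q::real. q powr (s m - s n)) at_top (at_right 0)"
      by (rule filterlim_powr_neg_at_right_0)
    then show ?thesis unfolding filterlim_at_top by (auto elim: eventually_mono)
  qed simp
  then have ev2: "\<forall>\<^sub>F q in at_right 0. \<forall>m\<in>I. s m < s n \<longrightarrow> q powr (s m - s n) \<ge> (1 + \<epsilon>)\<^sup>2"
    using fin by (intro eventually_ball_finite) auto
  have ev3: "\<forall>\<^sub>F q in at_right 0. 0 < q \<and> q < (1::real)"
    unfolding eventually_at_right_field by (auto intro!: exI[of _ 1])
  from ev1 ev2 ev3 real show ?thesis
  proof eventually_elim
    case (elim q)
    then have q: "0 < q" "q < 1" by auto
    define r where "r = q powr s n * t"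
    have r: "r > 0" using q t by (simp add: r_def)
    define y where "y = (1 + \<epsilon>) * r"
    have y: "y > 0" "r \<le> y" using mult_pos_pos[OF e r] r unfolding y_def distrib_right by auto
    have close: "\<bar>poly (c q) x - poly (P q) x\<bar> \<le> \<delta> * poly (P q) \<bar>x\<bar>" for x
    proof (rule abs_poly_diff_le)
      show "degree (c q) \<le> M" "degree (P q) \<le> M" using deg degP by (simp_all add: M_def)
      show "\<bar>coeff (c q) j - coeff (P q) j\<bar> \<le> \<delta> * coeff (P q) j" if "j \<le> M" for j
        using bspec[OF elim(1), of j] that nnP[OF q(1), of j] by simp
    qed
    have rm: "q powr s m * t > 0" for m using q t by simp
    have T: "poly (P q) y > 0"
      unfolding P_def poly_prod_linear using A[OF q(1)] y
      by (intro mult_pos_pos prod_pos add_pos_pos rm)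
    have "poly (P q) r \<le> poly (P q) y"
      unfolding P_def poly_prod_linear using A[OF q(1)] y r
      by (intro mult_left_mono prod_mono conjI add_nonneg_nonneg add_left_mono less_imp_le[OF rm]) simp_all
    moreover have "poly (P q) (- r) = 0"
      unfolding P_def poly_prod_linear using fin n by (auto simp: r_def)
    ultimately have small: "\<bar>poly (c q) (- r)\<bar> \<le> \<delta> * poly (P q) y"
      using close[of "- r"] r \<delta> by (smt (verit) mult_left_mono)
    \<comment> \<open>Either \<open>u \<ge> (1 + \<epsilon>) * y\<close> or
      \<open>u \<le> r = y / (1 + \<epsilon>)\<close>. Two positive numbers whose quotient is at
      least \<open>k = 1 + \<epsilon>\<close> have a difference of at least
      \<open>(k - 1) / (k + 1)\<close> times their sum.\<close>
    have sep: "\<epsilon> / (2 + \<epsilon>) * (q powr s m * t + y) \<le> \<bar>q powr s m * t - y\<bar>" if m: "m \<in> I" for m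
    proof (cases "s m < s n")
      case True
      define u where "u = q powr s m * t"
      have "(1 + \<epsilon>)\<^sup>2 * q powr s n \<le> q powr (s m - s n) * q powr s n"
        using bspec[OF elim(2) m] True by (intro mult_right_mono) simp_all
      then have "(1 + \<epsilon>)\<^sup>2 * r \<le> u"
        using t mult_right_mono[of _ _ t] unfolding r_def u_def by (simp flip: powr_add mult.assoc)
      then have "(1 + \<epsilon>) * y \<le> u" by (simp add: y_def power2_eq_square mult_ac)
      then have "\<epsilon> * (u + y) \<le> (2 + \<epsilon>) * (u - y)" by (simp add: algebra_simps)
      then have "\<epsilon> / (2 + \<epsilon>) * (u + y) \<le> u - y" using e by (simp add: field_simps)
      then show ?thesis unfolding u_def[symmetric] by linarith
    next
      case False
      define u where "u = q powr s m * t"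
      have "u \<le> r" using False q t unfolding u_def r_def
        by (intro mult_right_mono powr_mono') auto
      then have "\<epsilon> * u + u \<le> \<epsilon> * r + r" using e by (intro add_mono mult_left_mono) auto
      then have "\<epsilon> * (u + y) \<le> (2 + \<epsilon>) * (y - u)" by (simp add: algebra_simps y_def)
      then have "\<epsilon> / (2 + \<epsilon>) * (u + y) \<le> y - u" using e by (simp add: field_simps)
      then show ?thesis unfolding u_def[symmetric] by linarith
    qed
    have "\<kappa> * poly (P q) y = A q * (\<Prod>m\<in>I. \<epsilon> / (2 + \<epsilon>) * (q powr s m * t + y))"
      unfolding \<kappa>_def P_def poly_prod_linear prod.distrib by (simp add: M_def mult_ac)
    also have "\<dots> \<le> A q * (\<Prod>m\<in>I. \<bar>q powr s m * t - y\<bar>)"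
      using sep A[of q] q e rm y
      by (intro mult_left_mono prod_mono conjI mult_nonneg_nonneg add_nonneg_nonneg less_imp_le[OF rm]) simp_all
    also have "\<dots> = \<bar>poly (P q) (- y)\<bar>"
      unfolding P_def poly_prod_linear using A[of q] q by (simp add: abs_mult abs_prod)
    finally have big: "(\<kappa> - \<delta>) * poly (P q) y \<le> \<bar>poly (c q) (- y)\<bar>"
      using close[of "- y"] y by (simp add: algebra_simps)
    show ?case
    proof (rule ccontr)
      assume no: "\<not> ?case"
      let ?c = "map_poly complex_of_real (c q)"
      have "norm (poly ?c (of_real (- y))) \<le> 2 ^ M * norm (poly ?c (of_real (- r)))"
      proof (rule norm_poly_le_of_distant_roots)
        show "degree ?c \<le> M" using deg by (simp add: degree_map_poly M_def)
        fix z assume z: "poly ?c z = 0"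
        \<comment> \<open>Real-rootedness enters here: the negated claim keeps only real roots away
          from \<open>- r\<close>.\<close>
        then obtain x where x: "z = of_real x" using elim(4) by (auto elim: Reals_cases)
        have "poly (c q) x = 0" using z unfolding x poly_of_real_poly by simp
        then have "\<bar>x + r\<bar> > \<epsilon> * r" using no r by (auto simp: r_def not_le)
        moreover have "norm (complex_of_real (- r) - of_real (- y)) = \<epsilon> * r"
          using e r by (simp add: y_def algebra_simps flip: of_real_minus of_real_add of_real_mult)
        moreover have "norm (complex_of_real (- r) - z) = \<bar>x + r\<bar>"
          unfolding x of_real_diff[symmetric] norm_of_real by simp
        ultimately show "norm (complex_of_real (- r) - of_real (- y)) \<le> norm (complex_of_real (- r) - z)"
          by simp
      qed
      then have "\<bar>poly (c q) (- y)\<bar> \<le> 2 ^ M * \<bar>poly (c q) (- r)\<bar>"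
        unfolding poly_of_real_poly norm_of_real .
      also have "\<dots> \<le> 2 ^ M * (\<delta> * poly (P q) y)"
        using small by (intro mult_left_mono) auto
      finally have "(\<kappa> - \<delta>) * poly (P q) y \<le> 2 ^ M * \<delta> * poly (P q) y"
        using big by (simp add: mult_ac)
      then show False using \<delta>2 T by simp
    qed
  qed
qed

section \<open>Asymptotics of the coefficients of the q-Heun recurrence\<close>

lemma powr_smallo_powr_at_right_0:
  assumes "a < (b::real)"
  shows "(\<lambda>q::real. q powr b) \<in> o[at_right 0](\<lambda>q. q powr a)"
proof (rule smalloI_tendsto)
  have "((\<lambda>q::real. q powr (b - a)) \<longlongrightarrow> 0) (at_right 0)"
    using assms by real_asymp
  then show "((\<lambda>q::real. q powr b / q powr a) \<longlongrightarrow> 0) (at_right 0)"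
    by (simp add: powr_diff)
  show "\<forall>\<^sub>F q in at_right 0. q powr a \<noteq> (0::real)"
    by (auto simp: eventually_at_right_field intro!: exI[of _ 1])
qed

lemma one_minus_powr_asymp_equiv:
  assumes "a < (0::real)"
  shows "(\<lambda>q::real. 1 - q powr a) \<sim>[at_right 0] (\<lambda>q. - (q powr a))"
proof -
  have "(\<lambda>q::real. q powr 0) \<in> o[at_right 0](\<lambda>q. - (q powr a))"
    using powr_smallo_powr_at_right_0[OF assms] by simp
  \<comment> \<open>Only eventually, since \<open>0 powr 0 = 0\<close>.\<close>
  moreover have "\<forall>\<^sub>F q::real in at_right 0. q powr 0 = 1"
    by (auto simp: eventually_at_right_field intro!: exI[of _ 1])
  ultimately have "(\<lambda>q::real. 1) \<in> o[at_right 0](\<lambda>q. - (q powr a))"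
    by (subst (asm) landau_o.small.in_cong)
  then show ?thesis by (intro smallo_imp_asymp_equiv) simp
qed

lemma qheun_lead_asymp_equiv:
  assumes "\<beta> < 1" "n \<ge> 1"
  shows "(\<lambda>q. qheun_lead h1 h2 \<beta> t1 t2 q n) \<sim>[at_right 0] (\<lambda>q. t1 * t2 * q powr (h1 + h2))"
proof -
  have "((\<lambda>q::real. 1 - q powr (real n - \<beta>)) \<longlongrightarrow> 1) (at_right 0)"
    using assms by real_asymp
  moreover have "((\<lambda>q::real. 1 - q ^ n) \<longlongrightarrow> 1 - 0 ^ n) (at_right 0)"
    by (intro tendsto_intros)
  moreover have "0 ^ n = (0::real)" using assms by simp
  ultimately have "(\<lambda>q::real. 1 - q powr (real n - \<beta>)) \<sim>[at_right 0] (\<lambda>_. 1)"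
    "(\<lambda>q::real. 1 - q ^ n) \<sim>[at_right 0] (\<lambda>_. 1)"
    using assms by (auto intro!: tendsto_imp_asymp_equiv_const)
  then have "(\<lambda>q. qheun_lead h1 h2 \<beta> t1 t2 q n) \<sim>[at_right 0] (\<lambda>q. t1 * t2 * q powr (h1 + h2) * 1 * 1)"
    unfolding qheun_lead_def by (intro asymp_equiv_mult asymp_equiv_refl)
  then show ?thesis by simp
qed

text \<open>Both exponents are negative, so each bracket behaves like minus its power, and the two
  signs cancel.\<close>

lemma qheun_last_asymp_equiv:
  assumes lam: "lam = qheun_lambda h1 h2 l1 l2 \<alpha>1 \<alpha>2 \<beta>"
    and "real n - 2 + lam + \<alpha>1 < 0" "real n - 2 + lam + \<alpha>2 < 0"
  shows "(\<lambda>q. qheun_last h1 h2 l1 l2 \<alpha>1 \<alpha>2 \<beta> q n) \<sim>[at_right 0]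
    (\<lambda>q. q powr (2 * real n - 3 + 2 * lam + \<alpha>1 + \<alpha>2))"
proof -
  have "(\<lambda>q. qheun_last h1 h2 l1 l2 \<alpha>1 \<alpha>2 \<beta> q n) \<sim>[at_right 0]
    (\<lambda>q. q * - (q powr (real n - 2 + lam + \<alpha>1)) * - (q powr (real n - 2 + lam + \<alpha>2)))"
    unfolding qheun_last_def lam[symmetric] Let_def
    using assms by (intro asymp_equiv_mult one_minus_powr_asymp_equiv asymp_equiv_refl)
  also have "\<forall>\<^sub>F q in at_right 0. q * - (q powr (real n - 2 + lam + \<alpha>1)) * - (q powr (real n - 2 + lam + \<alpha>2))
      = q powr (2 * real n - 3 + 2 * lam + \<alpha>1 + \<alpha>2)"
    unfolding eventually_at_right_field
  proof (intro exI[of _ 1] conjI allI impI)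
    fix q :: real assume "0 < q"
    then have "q * - (q powr (real n - 2 + lam + \<alpha>1)) * - (q powr (real n - 2 + lam + \<alpha>2))
        = q powr 1 * (q powr (real n - 2 + lam + \<alpha>1) * q powr (real n - 2 + lam + \<alpha>2))" by simp
    also have "\<dots> = q powr (2 * real n - 3 + 2 * lam + \<alpha>1 + \<alpha>2)"
      unfolding powr_add[symmetric] by (simp add: algebra_simps)
    finally show "q * - (q powr (real n - 2 + lam + \<alpha>1)) * - (q powr (real n - 2 + lam + \<alpha>2))
      = q powr (2 * real n - 3 + 2 * lam + \<alpha>1 + \<alpha>2)" .
  qed simp
  finally show ?thesis .
qed

text \<open>Of the four powers of \<open>q\<close> in the constant term, \<open>h1 < h2\<close> and
  \<open>l1 < l2\<close> leave two candidates for the dominant one. Their exponents differ by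
  \<open>2 * n - 2 + (1 + h2 - l2 - \<beta>)\<close>, and the condition on \<open>K\<close> makes
  this negative for \<open>n \<le> K\<close> and positive for \<open>n > K\<close>, without a
  tie.\<close>

lemma qheun_mid_coeff_0_asymp_equiv:
  fixes n K :: nat
  assumes lam: "lam = qheun_lambda h1 h2 l1 l2 \<alpha>1 \<alpha>2 \<beta>"
    and h: "h1 < h2" and l: "l1 < l2" and t: "t1 > 0"
    and K: "- 2 * real K < 1 + h2 - l2 - \<beta>" "1 + h2 - l2 - \<beta> < - 2 * real K + 2"
  shows "(\<lambda>q. coeff (qheun_mid h1 h2 l1 l2 \<alpha>1 \<alpha>2 \<beta> t1 t2 q n) 0) \<sim>[at_right 0]
    (\<lambda>q. q powr (h1 + h2 + (if n \<le> K then 2 * real n - 1/2 - l2 - \<beta> else 1/2 - h2)) * t1)"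
proof -
  define X where "X = 2 * (real n + lam) + \<alpha>1 + \<alpha>2 - 5/2"
  have X: "l1 + X = h1 + h2 + (2 * real n - 1/2 - l2 - \<beta>)"
    unfolding X_def lam qheun_lambda_def by (simp add: field_simps)
  have eq: "coeff (qheun_mid h1 h2 l1 l2 \<alpha>1 \<alpha>2 \<beta> t1 t2 q n) 0 =
      q powr (1/2 + h1) * t1 + q powr (1/2 + h2) * t2 + q powr (l1 + X) * t1 + q powr (l2 + X) * t2" for q
    unfolding qheun_mid_def lam[symmetric] Let_def X_def[symmetric] by (simp add: powr_add algebra_simps)
  have o: "(\<lambda>q. q powr b * u) \<in> o[at_right 0](\<lambda>q. q powr a * t1)" if "a < b" for a b u :: real
    using powr_smallo_powr_at_right_0[OF that] t by (cases "u = 0") simp_all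
  show ?thesis
  proof (cases "n \<le> K")
    case True
    then have less: "l1 + X < 1/2 + h1" unfolding X using K by simp
    have "(\<lambda>q. (q powr (1/2 + h1) * t1 + q powr (1/2 + h2) * t2 + q powr (l2 + X) * t2) + q powr (l1 + X) * t1)
        \<sim>[at_right 0] (\<lambda>q. q powr (l1 + X) * t1)"
      using less h l by (subst asymp_equiv_add_left) (auto intro!: sum_in_smallo o)
    then show ?thesis using True unfolding eq X by (simp add: add_ac)
  next
    case False
    then have "real n \<ge> real K + 1" by simp
    then have less: "l1 + X > 1/2 + h1" unfolding X using K by simp
    have "(\<lambda>q. (q powr (1/2 + h2) * t2 + q powr (l1 + X) * t1 + q powr (l2 + X) * t2) + q powr (1/2 + h1) * t1)
        \<sim>[at_right 0] (\<lambda>q. q powr (1/2 + h1) * t1)"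
      using less h l by (subst asymp_equiv_add_left) (auto intro!: sum_in_smallo o)
    moreover have "h1 + h2 + (1/2 - h2) = 1/2 + h1" by simp
    ultimately show ?thesis using False unfolding eq by (simp add: add_ac)
  qed
qed

section \<open>Degree and real-rootedness of the q-Heun polynomials\<close>

lemma degree_qheun_c: "degree (qheun_c h1 h2 l1 l2 \<alpha>1 \<alpha>2 \<beta> t1 t2 q n) \<le> n"
proof (induction n rule: induct_nat_012)
  have mid: "degree (qheun_mid h1 h2 l1 l2 \<alpha>1 \<alpha>2 \<beta> t1 t2 q n) \<le> 1" for n
    by (simp add: qheun_mid_def Let_def)
  case 1
  then show ?case using mid[of 1] degree_smult_le order.trans by auto
  case (ge2 n)
  have "degree (qheun_c h1 h2 l1 l2 \<alpha>1 \<alpha>2 \<beta> t1 t2 q (Suc n) * qheun_mid h1 h2 l1 l2 \<alpha>1 \<alpha>2 \<beta> t1 t2 q (n + 2)) \<le> Suc (Suc n)"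
    using degree_mult_le[of "qheun_c h1 h2 l1 l2 \<alpha>1 \<alpha>2 \<beta> t1 t2 q (Suc n)" "qheun_mid h1 h2 l1 l2 \<alpha>1 \<alpha>2 \<beta> t1 t2 q (n + 2)"]
      mid[of "n + 2"] ge2 by linarith
  moreover have "degree (smult x (qheun_c h1 h2 l1 l2 \<alpha>1 \<alpha>2 \<beta> t1 t2 q n)) \<le> Suc (Suc n)" for x
    using degree_smult_le[of x "qheun_c h1 h2 l1 l2 \<alpha>1 \<alpha>2 \<beta> t1 t2 q n"] ge2 by linarith
  ultimately show ?case
    unfolding qheun_c.simps by (intro order.trans[OF degree_smult_le degree_diff_le])
qed auto

lemma poly_map_of_real:
  fixes z :: complex
  shows poly_map_of_real_diff: "poly (map_poly of_real (p - r)) z = poly (map_poly of_real p) z - poly (map_poly of_real r) z"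
    and poly_map_of_real_smult: "poly (map_poly of_real (smult x p)) z = of_real x * poly (map_poly of_real p) z"
    and poly_map_of_real_mult: "poly (map_poly of_real (p * r)) z = poly (map_poly of_real p) z * poly (map_poly of_real r) z"
proof -
  have ext: "map_poly of_real (p + r) = map_poly of_real p + (map_poly of_real r :: complex poly)"
    "map_poly of_real (p - r) = map_poly of_real p - (map_poly of_real r :: complex poly)"
    "map_poly of_real (smult x p) = smult (of_real x) (map_poly of_real p :: complex poly)" for p r x
    by (auto intro!: poly_eqI simp: coeff_map_poly)
  show "poly (map_poly of_real (p - r)) z = poly (map_poly of_real p) z - poly (map_poly of_real r) z"
   "poly (map_poly of_real (smult x p)) z = of_real x * poly (map_poly of_real p) z"
    by (simp_all add: ext)
  show "poly (map_poly of_real (p * r)) z = poly (map_poly of_real p) z * poly (map_poly of_real r) z"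
    by (induction p) (auto simp: map_poly_pCons ext algebra_simps)
qed

text \<open>After division by the positive leading factor, \<open>recurrence_Im_pos\<close> applies
  at a nonreal \<open>z\<close>: the middle coefficient has imaginary part a positive multiple of
  \<open>Im z\<close>, and the last coefficient is positive for
  \<open>2 \<le> n \<le> N + 1\<close>.\<close>

lemma qheun_c_real_rooted:
  assumes lam: "lam = qheun_lambda h1 h2 l1 l2 \<alpha>1 \<alpha>2 \<beta>"
    and N: "real N = - lam - \<alpha>1" and "\<beta> < 1" "\<alpha>2 - \<alpha>1 < 1" "t1 > 0" "t2 > 0"
    and q: "0 < q" "q < 1"
    and z: "poly (map_poly complex_of_real (qheun_c h1 h2 l1 l2 \<alpha>1 \<alpha>2 \<beta> t1 t2 q (N + 1))) z = 0"
  shows "z \<in> \<real>"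
proof (rule ccontr)
  assume "z \<notin> \<real>"
  then have z0: "Im z \<noteq> 0" using complex_is_Real_iff by blast
  let ?lead = "qheun_lead h1 h2 \<beta> t1 t2 q"
  let ?m = "\<lambda>n. smult (1 / ?lead n) (qheun_mid h1 h2 l1 l2 \<alpha>1 \<alpha>2 \<beta> t1 t2 q n)"
  let ?ev = "\<lambda>p. poly (map_poly complex_of_real p) z"
  let ?c = "\<lambda>n. ?ev (qheun_c h1 h2 l1 l2 \<alpha>1 \<alpha>2 \<beta> t1 t2 q n)"
  let ?d = "\<lambda>n. qheun_last h1 h2 l1 l2 \<alpha>1 \<alpha>2 \<beta> q n / ?lead n"
  have lead: "?lead n > 0" if "n \<ge> 1" for n
    using assms that by (intro qheun_lead_pos) auto
  have "?c N \<noteq> 0 \<and> ?c (Suc N) \<noteq> 0 \<and> Im z * Im (?c (Suc N) / ?c N) > 0"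
  proof (rule recurrence_Im_pos)
    show "?c (n + 2) = ?c (n + 1) * ?ev (?m (n + 2)) - of_real (?d (n + 2)) * ?c n" for n
      by (simp add: poly_map_of_real diff_divide_distrib)
    show "Im z * Im (?ev (?m n)) > 0" if "n \<ge> 1" for n
    proof -
      have "Im z * Im (?ev (?m n)) = (Im z)\<^sup>2 * (q powr (real n - 1 + lam) / ?lead n)"
        by (simp add: poly_map_of_real qheun_mid_def lam[symmetric] Let_def map_poly_pCons power2_eq_square)
      then show ?thesis using z0 lead[OF that] q by simp
    qed
    show "?d n > 0" if "2 \<le> n" "n \<le> N + 1" for n
    proof -
      have "1 < q powr e" if "e < 0" for e
        using powr_less_mono'[of q e 0] q that by simp
      \<comment> \<open>As \<open>lam + \<alpha>1 = - N\<close>, the first exponent is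
        \<open>n - 2 - N\<close>; by \<open>\<alpha>2 - \<alpha>1 < 1\<close> the second is below
        \<open>n - 1 - N \<le> 0\<close>.\<close>
      moreover have "real n - 2 + lam + \<alpha>1 < 0" "real n - 2 + lam + \<alpha>2 < 0"
        using that assms(2,4) by linarith+
      ultimately have "1 < q powr (real n - 2 + lam + \<alpha>1)" "1 < q powr (real n - 2 + lam + \<alpha>2)"
        by blast+
      then have "qheun_last h1 h2 l1 l2 \<alpha>1 \<alpha>2 \<beta> q n > 0"
        unfolding qheun_last_def lam[symmetric] Let_def using q
        by (intro mult_neg_neg mult_pos_neg) auto
      then show ?thesis using lead that by simp
    qed
  qed simp_all
  then show False using z by simp
qed

section \<open>Asymptotics and roots of the spectral polynomial\<close>

theorem theorem3p8:
  fixes h1 h2 l1 l2 \<alpha>1 \<alpha>2 \<beta> t1 t2 lam :: real and N K :: nat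
  assumes lam: "lam = qheun_lambda h1 h2 l1 l2 \<alpha>1 \<alpha>2 \<beta>"
    and N: "real N = - lam - \<alpha>1"
    and "\<beta> < 1" and "\<alpha>2 - \<alpha>1 < 1"
    and "t1 > 0" and "t2 > 0"
    and "h1 < h2" and "l1 < l2"
    and "h2 - l1 + 1 > 0"
    and "K \<in> {1..N}"
    and "- 2 * real K < 1 + h2 - l2 - \<beta>" and "1 + h2 - l2 - \<beta> < - 2 * real K + 2"
  shows
    "poly_asymp_equiv
       (\<lambda>q. qheun_c h1 h2 l1 l2 \<alpha>1 \<alpha>2 \<beta> t1 t2 q (N + 1))
       (\<lambda>q. smult ((t1 * t2) powi (- int N - 1))
          ((\<Prod>n=1..K. [: q powr (2 * real n - 1/2 - l2 - \<beta>) * t1,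
                         q powr (real n - 1 - h1 - h2 + lam) :])
           * (\<Prod>n=K+1..N+1. [: q powr (1/2 - h2) * t1,
                         q powr (real n - 1 - h1 - h2 + lam) :])))
     \<and> (\<forall>q. 0 < q \<and> q < 1 \<longrightarrow>
          smult ((t1 * t2) powi (- int N - 1))
            ((\<Prod>n=1..K. [: q powr (2 * real n - 1/2 - l2 - \<beta>) * t1,
                           q powr (real n - 1 - h1 - h2 + lam) :])
             * (\<Prod>n=K+1..N+1. [: q powr (1/2 - h2) * t1,
                           q powr (real n - 1 - h1 - h2 + lam) :]))
          = smult ((t1 * t2) powi (- int N - 1)
                     * q powr ((real N / 2 + lam - h1 - h2) * (real N + 1)))
            ((\<Prod>n=1..K. [: q powr (real n - 3/2 + lam + l1 + \<alpha>1 + \<alpha>2) * t1, 1 :])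
             * (\<Prod>n=K+1..N+1. [: q powr (- real n + 3/2 + h1 - lam) * t1, 1 :])))
     \<and> (\<exists>E :: nat \<Rightarrow> real \<Rightarrow> real.
          (\<forall>\<^sub>F q in at_right 0. \<forall>j\<in>{1..N+1}.
              poly (qheun_c h1 h2 l1 l2 \<alpha>1 \<alpha>2 \<beta> t1 t2 q (N + 1)) (E j q) = 0)
          \<and> (\<forall>j\<in>{1..K}.
              E j \<sim>[at_right 0] (\<lambda>q. - (q powr (real j - 3/2 + lam + l1 + \<alpha>1 + \<alpha>2)) * t1))
          \<and> (\<forall>j\<in>{K+1..N+1}.
              E j \<sim>[at_right 0] (\<lambda>q. - (q powr (- real j + 3/2 + h1 - lam)) * t1)))"
proof (intro conjI)
  \<comment> \<open>\<open>\<gamma> n\<close> and \<open>\<eta> n\<close> are the exponents of the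
    constant and linear coefficients of the \<open>n\<close>-th model factor, and
    \<open>\<sigma> n = \<gamma> n - \<eta> n\<close> is that of its root. Each factor
    \<open>b n\<close> carries one \<open>u\<close>, so that the global constant is absorbed into
    the product.\<close>
  define \<gamma> where "\<gamma> = (\<lambda>n. if n \<le> K then 2 * real n - 1/2 - l2 - \<beta> else 1/2 - h2)"
  define \<eta> where "\<eta> = (\<lambda>n. real n - 1 - h1 - h2 + lam)"
  define \<sigma> where "\<sigma> = (\<lambda>n. if n \<le> K then real n - 3/2 + lam + l1 + \<alpha>1 + \<alpha>2 else - real n + 3/2 + h1 - lam)"
  define u where "u = 1 / (t1 * t2)"
  have u: "u > 0" using assms by (simp add: u_def)
  define b where "b = (\<lambda>n q. smult u [:q powr \<gamma> n * t1, q powr \<eta> n:])"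
  let ?I = "{1..N + 1}"
  let ?c = "\<lambda>n q. qheun_c h1 h2 l1 l2 \<alpha>1 \<alpha>2 \<beta> t1 t2 q n"
  let ?lead = "\<lambda>n q. qheun_lead h1 h2 \<beta> t1 t2 q n"
  let ?last = "\<lambda>n q. qheun_last h1 h2 l1 l2 \<alpha>1 \<alpha>2 \<beta> q n"
  let ?mid = "\<lambda>n q. qheun_mid h1 h2 l1 l2 \<alpha>1 \<alpha>2 \<beta> t1 t2 q n"
  define P1 where "P1 = (\<lambda>q. smult ((t1 * t2) powi (- int N - 1))
          ((\<Prod>n=1..K. [: q powr (2 * real n - 1/2 - l2 - \<beta>) * t1,
                         q powr (real n - 1 - h1 - h2 + lam) :])
           * (\<Prod>n=K+1..N+1. [: q powr (1/2 - h2) * t1,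
                         q powr (real n - 1 - h1 - h2 + lam) :])))"
  define P2 where "P2 = (\<lambda>q. smult ((t1 * t2) powi (- int N - 1)
                     * q powr ((real N / 2 + lam - h1 - h2) * (real N + 1)))
            ((\<Prod>n=1..K. [: q powr (real n - 3/2 + lam + l1 + \<alpha>1 + \<alpha>2) * t1, 1 :])
             * (\<Prod>n=K+1..N+1. [: q powr (- real n + 3/2 + h1 - lam) * t1, 1 :])))"
  have lam2: "2 * lam = h1 + h2 - l1 - l2 - \<alpha>1 - \<alpha>2 - \<beta> + 2"
    by (simp add: lam qheun_lambda_def)
  have split: "(\<Prod>n\<in>?I. f n) = (\<Prod>n=1..K. f n) * (\<Prod>n=K+1..N+1. f n)" for f :: "nat \<Rightarrow> real poly"
    using prod.ub_add_nat[of 1 K f "N + 1 - K"] assms(10) by simp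
  have upow: "u ^ (N + 1) = (t1 * t2) powi (- int N - 1)"
  proof -
    have eq: "- int N - 1 = - int (N + 1)" by simp
    show ?thesis
      unfolding eq power_int_minus power_int_of_nat u_def by (simp only: power_one_over inverse_eq_divide)
  qed
  have P1: "P1 q = (\<Prod>n=1..N+1. b n q)" for q
    unfolding b_def prod_smult split P1_def \<gamma>_def \<eta>_def
    by (simp add: upow[symmetric] del: power_Suc)
  have P2: "P2 q = smult ((t1 * t2) powi (- int N - 1) * q powr ((real N / 2 + lam - h1 - h2) * (real N + 1)))
      (\<Prod>n\<in>?I. [:q powr \<sigma> n * t1, 1:])" for q
    unfolding split P2_def \<sigma>_def by simp
  have P12: "P1 q = P2 q" if q: "0 < q" for q
  proof -
    have "b n q = smult (u * q powr \<eta> n) [:q powr \<sigma> n * t1, 1:]" for n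
    proof -
      have "\<gamma> n = \<eta> n + \<sigma> n"
        unfolding \<gamma>_def \<eta>_def \<sigma>_def using lam2 by simp
      then show ?thesis using q by (simp add: b_def powr_add)
    qed
    then have "P1 q = smult (\<Prod>n\<in>?I. u * q powr \<eta> n) (\<Prod>n\<in>?I. [:q powr \<sigma> n * t1, 1:])"
      unfolding P1 by (simp only: prod_smult)
    \<comment> \<open>The exponent is the arithmetic sum of the \<open>\<eta> n\<close>; the case
      \<open>M = N + 1\<close> gives the prefactor of \<open>P2\<close>.\<close>
    moreover have "(\<Prod>n=1..M. u * q powr \<eta> n) = u ^ M * q powr (real M * ((real M - 1) / 2 + lam - h1 - h2))" for M
    proof (induction M)
      case (Suc M)
      have "real (Suc M) * ((real (Suc M) - 1) / 2 + lam - h1 - h2)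
          = real M * ((real M - 1) / 2 + lam - h1 - h2) + \<eta> (Suc M)"
        by (simp add: \<eta>_def field_simps)
      then show ?case using Suc by (simp add: powr_add)
    qed (use q in simp)
    moreover have "real (N + 1) * ((real (N + 1) - 1) / 2 + lam - h1 - h2)
        = (real N / 2 + lam - h1 - h2) * (real N + 1)"
      by (simp add: add.commute mult.commute)
    ultimately show ?thesis
      unfolding P2 by (simp only: upow)
  qed
  show "\<forall>q. 0 < q \<and> q < 1 \<longrightarrow> smult ((t1 * t2) powi (- int N - 1))
          ((\<Prod>n=1..K. [: q powr (2 * real n - 1/2 - l2 - \<beta>) * t1,
                         q powr (real n - 1 - h1 - h2 + lam) :])
           * (\<Prod>n=K+1..N+1. [: q powr (1/2 - h2) * t1,
                         q powr (real n - 1 - h1 - h2 + lam) :]))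
      = smult ((t1 * t2) powi (- int N - 1)
                     * q powr ((real N / 2 + lam - h1 - h2) * (real N + 1)))
            ((\<Prod>n=1..K. [: q powr (real n - 3/2 + lam + l1 + \<alpha>1 + \<alpha>2) * t1, 1 :])
             * (\<Prod>n=K+1..N+1. [: q powr (- real n + 3/2 + h1 - lam) * t1, 1 :]))"
    using P12 unfolding P1_def P2_def by blast
  have lead: "?lead n \<sim>[at_right 0] (\<lambda>q. t1 * t2 * q powr (h1 + h2))" if "n \<ge> 1" for n
    using assms that by (intro qheun_lead_asymp_equiv) auto
  have m: "poly_asymp_equiv (\<lambda>q. smult (1 / ?lead n q) (?mid n q)) (b n)" if "n \<ge> 1" for n
    unfolding poly_asymp_equiv_def
  proof
    fix j
    consider "j = 0" | "j = 1" | k where "j = Suc (Suc k)"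
      by (metis One_nat_def not0_implies_Suc)
    then show "(\<lambda>q. coeff (smult (1 / ?lead n q) (?mid n q)) j) \<sim>[at_right 0] (\<lambda>q. coeff (b n q) j)"
    proof cases
      case 1
      have "(\<lambda>q. coeff (?mid n q) 0 / ?lead n q) \<sim>[at_right 0]
          (\<lambda>q. q powr (h1 + h2 + \<gamma> n) * t1 / (t1 * t2 * q powr (h1 + h2)))"
        unfolding \<gamma>_def using assms that
        by (intro asymp_equiv_divide lead qheun_mid_coeff_0_asymp_equiv) auto
      \<comment> \<open>At \<open>q = 0\<close> both sides are 0, because
        \<open>0 powr a = 0\<close> and \<open>x / 0 = 0\<close>.\<close>
      moreover have "q powr (h1 + h2 + \<gamma> n) * t1 / (t1 * t2 * q powr (h1 + h2)) = coeff (b n q) 0" for q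
        by (cases "q = 0") (simp_all add: b_def u_def powr_add)
      ultimately show ?thesis using 1 by simp
    next
      case 2
      have "(\<lambda>q. q powr (real n - 1 + lam) / ?lead n q) \<sim>[at_right 0]
          (\<lambda>q. q powr (real n - 1 + lam) / (t1 * t2 * q powr (h1 + h2)))"
        using that by (intro asymp_equiv_divide lead asymp_equiv_refl)
      moreover have "q powr (real n - 1 + lam) / (t1 * t2 * q powr (h1 + h2)) = coeff (b n q) 1" for q
      proof -
        have "\<eta> n = real n - 1 + lam - (h1 + h2)" by (simp add: \<eta>_def)
        then show ?thesis by (simp add: b_def u_def powr_diff)
      qed
      ultimately show ?thesis using 2 by (simp add: qheun_mid_def lam[symmetric] Let_def)
    qed (simp add: b_def qheun_mid_def Let_def)
  qed
  have d: "(\<lambda>q. ?last n q / ?lead n q) \<in> o[at_right 0](\<lambda>q. coeff (b (n - 1) q) 0 * coeff (b n q) 0)"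
    if n: "2 \<le> n" "n \<le> N + 1" for n
  proof -
    define e where "e = 2 * real n - 3 + 2 * lam + \<alpha>1 + \<alpha>2"
    have neg: "real n - 2 + lam + \<alpha>1 < 0" "real n - 2 + lam + \<alpha>2 < 0"
      using n N assms(4) by linarith+
    have "(\<lambda>q. ?last n q / ?lead n q) \<sim>[at_right 0] (\<lambda>q. q powr e / (t1 * t2 * q powr (h1 + h2)))"
      unfolding e_def using n by (intro asymp_equiv_divide lead qheun_last_asymp_equiv[OF lam neg]) auto
    then have "(\<lambda>q. ?last n q / ?lead n q) \<in> O[at_right 0](\<lambda>q. q powr (e - (h1 + h2)) * u)"
      by (intro asymp_equiv_imp_bigo) (simp add: u_def powr_diff mult_ac)
    also have "(\<lambda>q. q powr (e - (h1 + h2)) * u) \<in> O[at_right 0](\<lambda>q. q powr (e - (h1 + h2)))"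
      by simp
    also have "(\<lambda>q. q powr (e - (h1 + h2))) \<in> o[at_right 0](\<lambda>q. q powr (\<gamma> (n - 1) + \<gamma> n))"
    proof (rule powr_smallo_powr_at_right_0)
      have r: "real (n - Suc 0) = real n - 1" using n by simp
      \<comment> \<open>\<open>\<gamma>\<close> is the minimum of its two branches. Bounding
        \<open>\<gamma> (n - 1)\<close> by the first branch and \<open>\<gamma> n\<close> by the
        second gives a sum independent of \<open>K\<close>, with no case distinction on where
        \<open>n\<close> lies.\<close>
      have "\<gamma> (n - 1) \<le> 2 * (real n - 1) - 1/2 - l2 - \<beta>"
      proof (cases "n - 1 \<le> K")
        case False
        then have "real n \<ge> real K + 2" by linarith
        then show ?thesis using False assms(11) by (simp add: \<gamma>_def r)
      qed (simp add: \<gamma>_def r)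
      moreover have "\<gamma> n \<le> 1/2 - h2"
      proof (cases "n \<le> K")
        case True
        then have "real n \<le> real K" by simp
        then show ?thesis using True assms(12) by (simp add: \<gamma>_def)
      qed (simp add: \<gamma>_def)
      ultimately have "\<gamma> (n - 1) + \<gamma> n \<le> (2 * (real n - 1) - 1/2 - l2 - \<beta>) + (1/2 - h2)"
        by (rule add_mono)
      also have "\<dots> < e - (h1 + h2)" \<comment> \<open>equivalent to \<open>h2 - l1 + 1 > 0\<close>\<close>
        unfolding e_def using lam2 assms(9) by simp
      finally show "\<gamma> (n - 1) + \<gamma> n < e - (h1 + h2)" .
    qed
    also have "(\<lambda>q. q powr (\<gamma> (n - 1) + \<gamma> n)) \<in> O[at_right 0](\<lambda>q. coeff (b (n - 1) q) 0 * coeff (b n q) 0)"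
    proof -
      have "coeff (b (n - 1) q) 0 * coeff (b n q) 0 = (u * t1)\<^sup>2 * q powr (\<gamma> (n - 1) + \<gamma> n)" for q
        by (simp add: b_def powr_add power2_eq_square)
      then show ?thesis using u assms(5) by simp
    qed
    finally show ?thesis .
  qed
  have main: "poly_asymp_equiv (?c (N + 1)) P1"
  proof -
    have "poly_asymp_equiv (?c (N + 1)) (\<lambda>q. \<Prod>i=1..N+1. b i q)"
    proof (rule poly_asymp_equiv_recurrence)
      show "?c (n + 2) q = ?c (n + 1) q * smult (1 / ?lead (n + 2) q) (?mid (n + 2) q)
          - smult (?last (n + 2) q / ?lead (n + 2) q) (?c n q)" for n q
        by (simp add: smult_diff_right)
      show "coeff (b n q) j \<ge> 0" for n q j
        using u assms(5) by (auto simp: b_def coeff_pCons split: nat.splits)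
    qed (use m d in auto)
    then show ?thesis unfolding P1 .
  qed
  then show "poly_asymp_equiv (?c (N + 1)) (\<lambda>q. smult ((t1 * t2) powi (- int N - 1))
          ((\<Prod>n=1..K. [: q powr (2 * real n - 1/2 - l2 - \<beta>) * t1,
                         q powr (real n - 1 - h1 - h2 + lam) :])
           * (\<Prod>n=K+1..N+1. [: q powr (1/2 - h2) * t1,
                         q powr (real n - 1 - h1 - h2 + lam) :])))"
    unfolding P1_def .
  define r where "r = (\<lambda>j q. - (q powr \<sigma> j) * t1)"
  have ev: "\<forall>\<^sub>F q in at_right 0. 0 < q \<and> q < (1::real)"
    unfolding eventually_at_right_field by (auto intro!: exI[of _ 1])
  have main2: "poly_asymp_equiv (?c (N + 1)) P2"
    using main unfolding poly_asymp_equiv_def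
  proof (rule all_forward)
    fix j assume "(\<lambda>q. coeff (?c (N + 1) q) j) \<sim>[at_right 0] (\<lambda>q. coeff (P1 q) j)"
    also have "\<forall>\<^sub>F q in at_right 0. coeff (P1 q) j = coeff (P2 q) j"
      using ev by eventually_elim (simp add: P12)
    finally show "(\<lambda>q. coeff (?c (N + 1) q) j) \<sim>[at_right 0] (\<lambda>q. coeff (P2 q) j)" .
  qed
  have real: "\<forall>\<^sub>F q in at_right 0. \<forall>z. poly (map_poly complex_of_real (?c (N + 1) q)) z = 0 \<longrightarrow> z \<in> \<real>"
    using ev by eventually_elim (use qheun_c_real_rooted[OF lam N assms(3-6)] in blast)
  \<comment> \<open>The zero polynomial would have the nonreal root \<open>\<i>\<close>.\<close>
  then have nz: "\<forall>\<^sub>F q in at_right 0. ?c (N + 1) q \<noteq> 0"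
    by eventually_elim (auto dest: spec[of _ \<i>] simp del: qheun_c.simps)
  have "\<exists>E. (\<forall>\<^sub>F q in at_right 0. poly (?c (N + 1) q) (E q) = 0) \<and> E \<sim>[at_right 0] r j" if "j \<in> ?I" for j
  proof (rule closest_root_asymp_equiv[OF nz])
    fix \<epsilon> :: real assume "\<epsilon> > 0"
    then show "\<forall>\<^sub>F q in at_right 0. \<exists>x. poly (?c (N + 1) q) x = 0 \<and> \<bar>x - r j q\<bar> \<le> \<epsilon> * \<bar>r j q\<bar>"
      unfolding r_def using that real main2[unfolded P2] degree_qheun_c assms(5,6)
      by (intro root_near_of_real_rooted[where A = "\<lambda>q. (t1 * t2) powi (- int N - 1) * q powr ((real N / 2 + lam - h1 - h2) * (real N + 1))" and I = ?I])
        (auto simp del: qheun_c.simps)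
  qed
  then obtain E where E: "\<And>j. j \<in> ?I \<Longrightarrow>
      (\<forall>\<^sub>F q in at_right 0. poly (?c (N + 1) q) (E j q) = 0) \<and> E j \<sim>[at_right 0] r j"
    by metis
  show "\<exists>E. (\<forall>\<^sub>F q in at_right 0. \<forall>j\<in>?I. poly (?c (N + 1) q) (E j q) = 0)
      \<and> (\<forall>j\<in>{1..K}. E j \<sim>[at_right 0] (\<lambda>q. - (q powr (real j - 3/2 + lam + l1 + \<alpha>1 + \<alpha>2)) * t1))
      \<and> (\<forall>j\<in>{K+1..N+1}. E j \<sim>[at_right 0] (\<lambda>q. - (q powr (- real j + 3/2 + h1 - lam)) * t1))"
  proof (intro exI[of _ E] conjI ballI)
    show "\<forall>\<^sub>F q in at_right 0. \<forall>j\<in>?I. poly (?c (N + 1) q) (E j q) = 0"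
      using E by (intro eventually_ball_finite) auto
  next
    fix j assume j: "j \<in> {1..K}"
    then have "E j \<sim>[at_right 0] r j" using E[of j] assms(10) by auto
    then show "E j \<sim>[at_right 0] (\<lambda>q. - (q powr (real j - 3/2 + lam + l1 + \<alpha>1 + \<alpha>2)) * t1)"
      using j by (simp add: r_def \<sigma>_def)
  next
    fix j assume j: "j \<in> {K+1..N+1}"
    then have "E j \<sim>[at_right 0] r j" using E[of j] by auto
    then show "E j \<sim>[at_right 0] (\<lambda>q. - (q powr (- real j + 3/2 + h1 - lam)) * t1)"
      using j by (simp add: r_def \<sigma>_def)
  qed
qed

end
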